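(* Let $m$ be a natural number. Then $\omega\to(\widetilde{\mathcal{ED}}_m^+)^2_{m+1}$ but $\omega\not\to(\widetilde{\mathcal{ED}}_m^+)^2_{m+2}$.
   Context: Fix a family $\{A_s\subseteq\omega: s\in\omega^{<\omega}\}$ such that $A_\emptyset=\omega$, every $A_s$ is infinite, $\{A_{s^\frown n}:n\in\omega\}$ is a partition of $A_s$, and for distinct $n,m\in\omega$ there exist $s\neq t$ in $\omega^{<\omega}$ with $n\in A_s$, $m\in A_t$. Let $\mathcal{B}=\{A\subseteq\omega: \exists s\in\omega^{<\omega}\,(A\subseteq A_s\wedge\forall n\in\omega\ |A\cap A_{s^\frown n}|=1)\}$ and $\mathcal{A}_m=\{A_s: |s|=m+1\}$. $\widetilde{\mathcal{ED}}_m$ is the ideal on $\omega$ generated by $\mathcal{A}_m\cup\mathcal{B}$ (and the finite sets). For an ideal $\mathcal{I}$, $\mathcal{I}^+$ is the family of subsets of $\omega$ not in $\mathcal{I}$, and $\omega\to(\mathcal{I}^+)^2_k$ means: for every $c:[\omega]^2\to k$ there is $A\in\mathcal{I}^+$ with $|c[[A]^2]|=1$. *)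

theory Defs
  imports "HOL.Hull" "HOL-Library.Ramsey" "HOL-Library.Disjoint_Sets"
begin

text \<open>
  Finite sequences of naturals are lists; \<open>s @ [n]\<close> is the one-step extension of \<open>s\<close> by \<open>n\<close>.
  The pieces of \<open>A s\<close> form a partition as an indexed family: \<open>A (s @ [n])\<close> and \<open>A (s @ [k])\<close>
  are disjoint whenever \<open>n \<noteq> k\<close>; their nonemptiness follows from infinitude.

  The last clause is the literal form of the separation requirement. Given the other clauses it
  is automatic (take \<open>s = []\<close> and a one-element \<open>t\<close>), so every family satisfying a stricter
  separation condition is covered as well.
\<close>

definition partition_tree :: "(nat list \<Rightarrow> nat set) \<Rightarrow> bool" where
  "partition_tree A \<longleftrightarrow>
     A [] = UNIV \<and>
     (\<forall>s. infinite (A s)) \<and>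
     (\<forall>s. disjoint_family (\<lambda>n. A (s @ [n])) \<and> (\<Union>n. A (s @ [n])) = A s) \<and>
     (\<forall>n k. n \<noteq> k \<longrightarrow> (\<exists>s t. s \<noteq> t \<and> n \<in> A s \<and> k \<in> A t))"

definition selectors :: "(nat list \<Rightarrow> nat set) \<Rightarrow> nat set set" where
  "selectors A = {X. \<exists>s. X \<subseteq> A s \<and> (\<forall>n. card (X \<inter> A (s @ [n])) = 1)}"

definition level_sets :: "(nat list \<Rightarrow> nat set) \<Rightarrow> nat \<Rightarrow> nat set set" where
  "level_sets A m = {A s | s. length s = m + 1}"

text \<open>
  Ideals contain all finite sets. Properness is not built in, so that the generated ideal below
  is always the least ideal containing the generators.
\<close>

definition set_ideal :: "'a set set \<Rightarrow> bool" where
  "set_ideal I \<longleftrightarrow>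
     (\<forall>X. finite X \<longrightarrow> X \<in> I) \<and>
     (\<forall>X\<in>I. \<forall>Y. Y \<subseteq> X \<longrightarrow> Y \<in> I) \<and>
     (\<forall>X\<in>I. \<forall>Y\<in>I. X \<union> Y \<in> I)"

definition ED_ideal :: "(nat list \<Rightarrow> nat set) \<Rightarrow> nat \<Rightarrow> nat set set" where
  "ED_ideal A m = set_ideal hull (level_sets A m \<union> selectors A)"

definition positive_sets :: "'a set set \<Rightarrow> 'a set set" where
  "positive_sets I = {X. X \<notin> I}"

text \<open>
  The arrow relation for pairs with \<open>k\<close> colours, the set of colours being \<open>{..<k}\<close>;
  \<open>nsets X 2\<close> is the set of two-element subsets of \<open>X\<close>.
\<close>

definition arrows_pairs :: "nat set set \<Rightarrow> nat \<Rightarrow> bool" where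
  "arrows_pairs P k \<longleftrightarrow>
     (\<forall>c :: nat set \<Rightarrow> nat. c \<in> nsets UNIV 2 \<rightarrow> {..<k} \<longrightarrow>
        (\<exists>X\<in>P. card (c ` nsets X 2) = 1))"

end

theory Submission
  imports Defs
begin

text \<open>
  A set that meets infinitely many pieces of some \<open>A s\<close> with \<open>length s \<le> m\<close> in unboundedly many
  points is positive. Fix a free ultrafilter \<open>V\<close> and attach to each \<open>s\<close> with \<open>length s \<le> m + 1\<close> a free
  ultrafilter \<open>U s\<close> on \<open>A s\<close>: the image of \<open>V\<close> under an enumeration of \<open>A s\<close> if \<open>length s = m + 1\<close>, and
  otherwise the \<open>V\<close>-limit of the \<open>U (s @ [n])\<close>. A colouring has a limit colour along \<open>U s \<otimes> U s\<close>, and every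
  set in \<open>U s\<close> contains large finite sets homogeneous in that colour. Passing from the pieces to
  their parent, either the limit colour of \<open>U s\<close> is already a colour of large homogeneous sets in
  \<open>V\<close>-most pieces, and gluing such sets gives a positive homogeneous set, or the parent has a new
  colour. Without a positive homogeneous set the root would therefore see \<open>m + 2\<close> colours.

  Conversely, colour \<open>{x, y}\<close> by the largest level \<open>\<le> m + 1\<close> at which \<open>x\<close> and \<open>y\<close> lie in a common \<open>A s\<close>:
  a homogeneous set lies in a selector or in a set of level \<open>m + 1\<close>.
\<close>

section \<open>Ultrafilters and limits of ultrafilters\<close>

definition ultrafilter :: "'a filter \<Rightarrow> bool" where
  "ultrafilter F \<longleftrightarrow> F \<noteq> bot \<and> (\<forall>P. eventually P F \<or> eventually (\<lambda>x. \<not> P x) F)"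

lemma ultrafilter_filtermap: "ultrafilter F \<Longrightarrow> ultrafilter (filtermap f F)"
  unfolding ultrafilter_def by (auto simp: filtermap_bot_iff eventually_filtermap)

lemma ultrafilter_happens: "ultrafilter F \<Longrightarrow> eventually P F \<Longrightarrow> \<exists>x. P x"
  unfolding ultrafilter_def by (blast dest: eventually_happens)

text \<open>Smaller filters are finer, so Zorn is applied to the reversed order and yields a minimal
  proper filter \<open>M\<close>. It decides every \<open>P\<close>: adjoining \<open>P\<close>
  either makes \<open>M\<close> improper, and then the negation of \<open>P\<close> is large, or
  leaves \<open>M\<close> unchanged.\<close>

lemma ex_ultrafilter_le:
  fixes F :: "'a filter"
  assumes "F \<noteq> bot"
  shows "\<exists>G\<le>F. ultrafilter G"
proof -
  let ?S = "{G. G \<noteq> bot \<and> G \<le> F}"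
  let ?R = "\<lambda>G H. H \<le> (G :: 'a filter)"
  have "\<exists>M\<in>?S. \<forall>G\<in>?S. ?R M G \<longrightarrow> G = M"
  proof (rule predicate_Zorn)
    show "partial_order_on ?S (relation_of ?R ?S)"
      by (rule partial_order_on_relation_ofI) auto
  next
    fix C assume C: "C \<in> Chains (relation_of ?R ?S)"
    then have CS: "C \<subseteq> ?S" and chain: "\<And>G H. G \<in> C \<Longrightarrow> H \<in> C \<Longrightarrow> G \<le> H \<or> H \<le> G"
      by (auto simp: Chains_def relation_of_def)
    show "\<exists>B\<in>?S. \<forall>G\<in>C. ?R G B"
    proof (cases "C = {}")
      case True
      then show ?thesis using assms by auto
    next
      case False
      \<comment> \<open>A nonempty chain is a filter base, so its infimum is improper only if some
        member is.\<close>
      have "eventually (\<lambda>x. False) (Inf C) \<longleftrightarrow> (\<exists>G\<in>C. eventually (\<lambda>x. False) G)"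
        using False chain by (intro eventually_Inf_base) (metis inf.absorb1 inf.absorb2 order_refl)+
      then have "Inf C \<noteq> bot"
        using CS by (auto simp: trivial_limit_def)
      moreover have "Inf C \<le> F"
      proof -
        obtain G where "G \<in> C" using False by blast
        then show ?thesis using CS by (intro Inf_lower2[of G]) auto
      qed
      ultimately show ?thesis
        by (intro bexI[of _ "Inf C"]) (auto intro: Inf_lower)
    qed
  qed
  then obtain M where M: "M \<noteq> bot" "M \<le> F"
    and max: "\<And>G. G \<noteq> bot \<Longrightarrow> G \<le> F \<Longrightarrow> G \<le> M \<Longrightarrow> G = M"
    by blast
  have "eventually P M \<or> eventually (\<lambda>x. \<not> P x) M" for P
  proof (cases "inf M (principal {x. P x}) = bot")
    case True
    then show ?thesis
      by (simp add: trivial_limit_def eventually_inf_principal)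
  next
    case False
    then have eq: "inf M (principal {x. P x}) = M"
      using M by (intro max) (auto intro: le_infI1)
    have "eventually P M"
      by (subst eq[symmetric]) (simp add: eventually_inf_principal)
    then show ?thesis ..
  qed
  then show ?thesis
    using M by (auto simp: ultrafilter_def)
qed

lemma ultrafilter_finite_range:
  fixes f :: "'a \<Rightarrow> 'b"
  assumes F: "ultrafilter F" and "finite C" and "\<forall>\<^sub>F x in F. f x \<in> C"
  shows "\<exists>v\<in>C. \<forall>\<^sub>F x in F. f x = v"
proof (rule ccontr)
  assume "\<not> ?thesis"
  then have "\<forall>v\<in>C. \<forall>\<^sub>F x in F. f x \<noteq> v"
    using F by (auto simp: ultrafilter_def)
  then have "\<forall>\<^sub>F x in F. \<forall>v\<in>C. f x \<noteq> v"
    using \<open>finite C\<close> by (simp add: eventually_ball_finite)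
  with assms(3) have "\<forall>\<^sub>F x in F. False"
    by eventually_elim blast
  then show False
    using F by (simp add: ultrafilter_def)
qed

text \<open>This is the limit of the filters \<open>G n\<close> along \<open>F\<close>, also known
  as their sum over \<open>F\<close>.\<close>

definition filter_bind :: "'a filter \<Rightarrow> ('a \<Rightarrow> 'b filter) \<Rightarrow> 'b filter" where
  "filter_bind F G = Abs_filter (\<lambda>P. \<forall>\<^sub>F n in F. eventually P (G n))"

lemma eventually_filter_bind:
  "eventually P (filter_bind F G) \<longleftrightarrow> (\<forall>\<^sub>F n in F. eventually P (G n))"
  unfolding filter_bind_def
proof (rule eventually_Abs_filter, unfold_locales)
  show "\<forall>\<^sub>F n in F. \<forall>\<^sub>F x in G n. P x \<and> Q x"
    if "\<forall>\<^sub>F n in F. eventually P (G n)" "\<forall>\<^sub>F n in F. eventually Q (G n)" for P Q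
    using that by eventually_elim (rule eventually_conj)
  show "\<forall>\<^sub>F n in F. eventually Q (G n)"
    if "\<forall>x. P x \<longrightarrow> Q x" "\<forall>\<^sub>F n in F. eventually P (G n)" for P Q
    using that(2) by eventually_elim (use that(1) in \<open>auto elim: eventually_mono\<close>)
qed simp

lemma ultrafilter_bind:
  assumes F: "ultrafilter F" and G: "\<And>n. ultrafilter (G n)"
  shows "ultrafilter (filter_bind F G)"
  unfolding ultrafilter_def
proof (intro conjI allI)
  show "filter_bind F G \<noteq> bot"
    using assms unfolding ultrafilter_def trivial_limit_def by (simp add: eventually_filter_bind)
next
  fix P
  have "(\<forall>\<^sub>F n in F. eventually P (G n)) \<or> (\<forall>\<^sub>F n in F. \<not> eventually P (G n))"
    using F unfolding ultrafilter_def by blast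
  moreover have "eventually (\<lambda>x. \<not> P x) (G n)" if "\<not> eventually P (G n)" for n
    using G[of n] that by (auto simp: ultrafilter_def)
  ultimately show "eventually P (filter_bind F G) \<or> eventually (\<lambda>x. \<not> P x) (filter_bind F G)"
    unfolding eventually_filter_bind by (metis (mono_tags, lifting) eventually_mono)
qed

lemma filter_bind_le:
  assumes "\<And>n. G n \<le> H"
  shows "filter_bind F G \<le> H"
  using assms by (auto simp: le_filter_def eventually_filter_bind)

section \<open>Homogeneous sets and limit colours\<close>

text \<open>Sets with at most one point qualify for every colour. This lets inductions start at the
  empty set, but a use in the arrow relation must supply two distinct points.\<close>

definition homogeneous :: "(nat set \<Rightarrow> nat) \<Rightarrow> nat \<Rightarrow> nat set \<Rightarrow> bool" where
  "homogeneous c p H \<longleftrightarrow> (\<forall>x\<in>H. \<forall>y\<in>H. x \<noteq> y \<longrightarrow> c {x, y} = p)"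

lemma homogeneous_Un:
  assumes "homogeneous c p H" "homogeneous c p K" "\<And>x y. x \<in> H \<Longrightarrow> y \<in> K \<Longrightarrow> c {x, y} = p"
  shows "homogeneous c p (H \<union> K)"
  using assms unfolding homogeneous_def by (metis Un_iff insert_commute)

lemma homogeneous_UN_chain:
  assumes "\<And>i::nat. homogeneous c p (S i)" "\<And>i. S i \<subseteq> S (Suc i)"
  shows "homogeneous c p (\<Union>i. S i)"
  unfolding homogeneous_def
proof (intro ballI impI)
  fix x y assume xy: "x \<in> (\<Union>i. S i)" "y \<in> (\<Union>i. S i)" "x \<noteq> y"
  then obtain i j where "x \<in> S i" "y \<in> S j" by blast
  moreover have "S i \<subseteq> S (max i j)" "S j \<subseteq> S (max i j)"
    by (rule lift_Suc_mono_le[of S], rule assms, simp)+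
  ultimately show "c {x, y} = p"
    using assms(1)[of "max i j"] xy(3) unfolding homogeneous_def by blast
qed

lemma homogeneous_card_image:
  assumes "homogeneous c p H" "x \<in> H" "y \<in> H" "x \<noteq> y"
  shows "card (c ` nsets H 2) = 1"
proof -
  have "c ` nsets H 2 = {p}"
  proof
    show "c ` nsets H 2 \<subseteq> {p}"
      using assms(1) by (auto simp: nsets_def card_2_iff homogeneous_def)
    have "{x, y} \<in> nsets H 2" "c {x, y} = p"
      using assms by (auto simp: nsets_def homogeneous_def)
    then show "{p} \<subseteq> c ` nsets H 2" by auto
  qed
  then show ?thesis by simp
qed

text \<open>Finite sets are required because gluing later chooses points that agree with all points
  chosen before, and a filter secures only finitely many such conditions at once.\<close>

definition rich :: "(nat set \<Rightarrow> nat) \<Rightarrow> nat filter \<Rightarrow> nat \<Rightarrow> bool" where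
  "rich c U p \<longleftrightarrow> (\<forall>P N. eventually P U \<longrightarrow>
     (\<exists>H. H \<subseteq> Collect P \<and> finite H \<and> card H = N \<and> homogeneous c p H))"

text \<open>Points are picked one by one from the large set \<open>D\<close> of points joined in
  colour \<open>p\<close> to \<open>U\<close>-most points. The finitely many points already chosen
  leave a large set of candidates, and freeness of \<open>U\<close> makes the next point
  new.\<close>

lemma rich_of_limit_colour:
  assumes U: "ultrafilter U" "U \<le> cofinite"
    and lim: "\<forall>\<^sub>F x in U. \<forall>\<^sub>F y in U. c {x, y} = p"
  shows "rich c U p"
  unfolding rich_def
proof (intro allI impI)
  fix P N assume P: "eventually P U"
  define D where "D = {x. P x \<and> (\<forall>\<^sub>F y in U. c {x, y} = p)}"
  have D: "\<forall>\<^sub>F x in U. x \<in> D"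
    using P lim by eventually_elim (simp add: D_def)
  have "\<exists>H. H \<subseteq> D \<and> finite H \<and> card H = N \<and> homogeneous c p H"
  proof (induction N)
    case 0
    show ?case by (intro exI[of _ "{}"]) (auto simp: homogeneous_def)
  next
    case (Suc N)
    then obtain H where H: "H \<subseteq> D" "finite H" "card H = N" "homogeneous c p H" by blast
    have "\<forall>\<^sub>F y in U. \<forall>x\<in>H. c {x, y} = p"
      using H by (intro eventually_ball_finite) (auto simp: D_def)
    moreover have "\<forall>\<^sub>F y in U. y \<notin> H"
      using U(2) H(2) by (auto simp: le_filter_def eventually_cofinite)
    ultimately have "\<forall>\<^sub>F y in U. y \<in> D \<and> y \<notin> H \<and> (\<forall>x\<in>H. c {x, y} = p)"
      using D by eventually_elim blast
    then obtain y where y: "y \<in> D" "y \<notin> H" "\<And>x. x \<in> H \<Longrightarrow> c {x, y} = p"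
      using ultrafilter_happens[OF U(1)] by blast
    have "homogeneous c p (H \<union> {y})"
      using H y by (intro homogeneous_Un) (auto simp: homogeneous_def)
    then show ?case
      using H y by (intro exI[of _ "H \<union> {y}"]) auto
  qed
  then show "\<exists>H. H \<subseteq> Collect P \<and> finite H \<and> card H = N \<and> homogeneous c p H"
    unfolding D_def by blast
qed

lemma ex_limit_colour:
  assumes U: "ultrafilter U" "U \<le> cofinite" and c: "c \<in> nsets UNIV 2 \<rightarrow> {..<k :: nat}"
  shows "\<exists>p<k. \<forall>\<^sub>F x in U. \<forall>\<^sub>F y in U. c {x, y} = p"
proof -
  have "\<exists>p\<in>{..<k}. \<forall>\<^sub>F y in U. c {x, y} = p" for x
  proof (rule ultrafilter_finite_range)
    \<comment> \<open>The value \<open>c {x, x}\<close> is unconstrained, since a singleton is not a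
      pair; freeness discards it.\<close>
    have "\<forall>\<^sub>F y in U. y \<noteq> x"
      using U(2) by (auto simp: le_filter_def eventually_cofinite)
    then show "\<forall>\<^sub>F y in U. c {x, y} \<in> {..<k}"
      by eventually_elim (use c in \<open>auto simp: nsets_def Pi_def\<close>)
  qed (use U in simp_all)
  then obtain f where f: "\<And>x. f x \<in> {..<k}" "\<And>x. \<forall>\<^sub>F y in U. c {x, y} = f x"
    by metis
  have "\<exists>p\<in>{..<k}. \<forall>\<^sub>F x in U. f x = p"
    using U f by (intro ultrafilter_finite_range) auto
  then obtain p where "p < k" "\<forall>\<^sub>F x in U. f x = p" by blast
  then have "\<forall>\<^sub>F x in U. \<forall>\<^sub>F y in U. c {x, y} = p"
    using f(2) by (auto elim: eventually_mono)
  with \<open>p < k\<close> show ?thesis by blast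
qed

section \<open>The partition tree and a necessary condition for membership in the ideal\<close>

lemma partition_tree_mono: "partition_tree A \<Longrightarrow> A (s @ t) \<subseteq> A s"
proof (induction t rule: rev_induct)
  case (snoc n t)
  then have "A ((s @ t) @ [n]) \<subseteq> A (s @ t)"
    unfolding partition_tree_def by (metis UN_upper UNIV_I)
  then show ?case using snoc by simp
qed simp

lemma partition_tree_disjoint:
  assumes A: "partition_tree A" and "length s = length t" "x \<in> A s" "x \<in> A t"
  shows "s = t"
  using assms(2-)
proof (induction s arbitrary: t rule: rev_induct)
  case (snoc n s)
  then obtain k t' where t: "t = t' @ [k]"
    by (metis append_butlast_last_id length_0_conv snoc_eq_iff_butlast)
  have "x \<in> A s" "x \<in> A t'"
    using snoc.prems partition_tree_mono[OF A] unfolding t by blast+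
  with snoc t have "s = t'" by simp
  moreover have "n = k"
    using A snoc.prems unfolding t \<open>s = t'\<close> partition_tree_def disjoint_family_on_def by blast
  ultimately show ?case using t by simp
qed simp

lemma partition_tree_comparable:
  assumes A: "partition_tree A" and "x \<in> A s" "x \<in> A t" "length s \<le> length t"
  shows "take (length s) t = s"
proof -
  have "x \<in> A (take (length s) t)"
    using partition_tree_mono[OF A, of "take (length s) t" "drop (length s) t"] assms(3) by auto
  then show ?thesis
    using assms by (intro partition_tree_disjoint[OF A, of _ _ x]) auto
qed

text \<open>One \<open>N\<close> serves as threshold and as bound, since either may be increased;
  for unions the two numbers are added. Finiteness is stated separately because \<open>card\<close>
  of an infinite set is 0.\<close>

lemma set_ideal_bounded_columns:
  "set_ideal {X :: 'a set. \<exists>N. \<forall>n\<ge>N. finite (X \<inter> B n) \<and> card (X \<inter> B n) \<le> (N :: nat)}"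
  unfolding set_ideal_def
proof (intro conjI allI ballI impI)
  fix X :: "'a set" assume "finite X"
  then show "X \<in> {X. \<exists>N. \<forall>n\<ge>N. finite (X \<inter> B n) \<and> card (X \<inter> B n) \<le> N}"
    by (auto intro!: exI[of _ "card X"] card_mono)
next
  fix X Y assume "X \<in> {X. \<exists>N. \<forall>n\<ge>N. finite (X \<inter> B n) \<and> card (X \<inter> B n) \<le> N}" "Y \<subseteq> X"
  then obtain N where "\<forall>n\<ge>N. finite (X \<inter> B n) \<and> card (X \<inter> B n) \<le> N" by blast
  then have "\<forall>n\<ge>N. finite (Y \<inter> B n) \<and> card (Y \<inter> B n) \<le> N"
    using \<open>Y \<subseteq> X\<close> by (meson Int_mono card_mono finite_subset order_refl order_trans)
  then show "Y \<in> {X. \<exists>N. \<forall>n\<ge>N. finite (X \<inter> B n) \<and> card (X \<inter> B n) \<le> N}" by blast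
next
  fix X Y assume "X \<in> {X. \<exists>N. \<forall>n\<ge>N. finite (X \<inter> B n) \<and> card (X \<inter> B n) \<le> N}"
    "Y \<in> {X. \<exists>N. \<forall>n\<ge>N. finite (X \<inter> B n) \<and> card (X \<inter> B n) \<le> N}"
  then obtain N M where N: "\<forall>n\<ge>N. finite (X \<inter> B n) \<and> card (X \<inter> B n) \<le> N"
    and M: "\<forall>n\<ge>M. finite (Y \<inter> B n) \<and> card (Y \<inter> B n) \<le> M" by blast
  have "finite ((X \<union> Y) \<inter> B n) \<and> card ((X \<union> Y) \<inter> B n) \<le> N + M" if "n \<ge> N + M" for n
  proof -
    have "card ((X \<union> Y) \<inter> B n) \<le> card (X \<inter> B n) + card (Y \<inter> B n)"
      by (simp add: Int_Un_distrib2 card_Un_le)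
    moreover have "finite (X \<inter> B n)" "card (X \<inter> B n) \<le> N" "finite (Y \<inter> B n)" "card (Y \<inter> B n) \<le> M"
      using N M that by auto
    ultimately show ?thesis
      by (simp add: Int_Un_distrib2)
  qed
  then show "X \<union> Y \<in> {X. \<exists>N. \<forall>n\<ge>N. finite (X \<inter> B n) \<and> card (X \<inter> B n) \<le> N}" by blast
qed

text \<open>The sets with bounded columns below \<open>s\<close> form an ideal, so only the
  generators need checking. This is the test by which sets are shown to be positive.\<close>

lemma ED_ideal_bounded_columns:
  assumes A: "partition_tree A" and s: "length s \<le> m" and X: "X \<in> ED_ideal A m"
  shows "\<exists>N. \<forall>n\<ge>N. finite (X \<inter> A (s @ [n])) \<and> card (X \<inter> A (s @ [n])) \<le> N"
proof -
  let ?J = "{X. \<exists>N. \<forall>n\<ge>N. finite (X \<inter> A (s @ [n])) \<and> card (X \<inter> A (s @ [n])) \<le> N}"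
  \<comment> \<open>Only the piece of \<open>A s\<close> with index \<open>t ! length s\<close> can
    meet \<open>A t\<close>, so the threshold lies just past that index. With
    \<open>length s <= m\<close> this covers all level sets.\<close>
  have below: "Y \<in> ?J" if t: "length s < length t" and Y: "Y \<subseteq> A t" for t Y
  proof -
    have "Y \<inter> A (s @ [n]) = {}" if "n \<ge> Suc (t ! length s)" for n
    proof (rule ccontr)
      assume "Y \<inter> A (s @ [n]) \<noteq> {}"
      then obtain x where "x \<in> A (s @ [n])" "x \<in> A t" using Y by blast
      then have "take (length (s @ [n])) t = s @ [n]"
        using t by (intro partition_tree_comparable[OF A]) auto
      then have "t ! length s = n"
        by (metis length_append_singleton lessI nth_append_length nth_take)
      with that show False by simp
    qed
    then show ?thesis
      by (auto intro!: exI[of _ "Suc (t ! length s)"])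
  qed
  have "X \<in> ?J" if X: "X \<in> selectors A" for X
  proof -
    obtain t where t: "X \<subseteq> A t" "\<And>n. card (X \<inter> A (t @ [n])) = 1"
      using X unfolding selectors_def by blast
    show ?thesis
    proof (cases "length s < length t")
      case True
      then show ?thesis using below t(1) by blast
    next
      case False
      \<comment> \<open>Here \<open>t\<close> is no longer than \<open>s\<close>. If the piece meets
        \<open>X\<close>, then \<open>s @ [n]\<close> properly extends \<open>t\<close>, so the
        piece lies within one piece \<open>A (t @ [k])\<close>, where the selector has a single
        point.\<close>
      have "finite (X \<inter> A (s @ [n])) \<and> card (X \<inter> A (s @ [n])) \<le> 1" for n
      proof (cases "X \<inter> A (s @ [n]) = {}")
        case nonempty: False
        then obtain x where x: "x \<in> A t" "x \<in> A (s @ [n])" using t(1) by blast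
        then have tk: "take (length t) (s @ [n]) = t"
          using False by (intro partition_tree_comparable[OF A]) auto
        obtain k r where kr: "drop (length t) (s @ [n]) = k # r"
          using False by (cases "drop (length t) (s @ [n])") auto
        have "s @ [n] = (t @ [k]) @ r"
          using append_take_drop_id[of "length t" "s @ [n]", unfolded tk kr] by simp
        then have "A (s @ [n]) \<subseteq> A (t @ [k])"
          using partition_tree_mono[OF A] by metis
        then have "X \<inter> A (s @ [n]) \<subseteq> X \<inter> A (t @ [k])" by blast
        moreover have "finite (X \<inter> A (t @ [k]))"
          using t(2)[of k] card_ge_0_finite by force
        ultimately show ?thesis
          using t(2)[of k] by (metis card_mono finite_subset)
      qed simp
      then show ?thesis by blast
    qed
  qed
  moreover have "X \<in> ?J" if "X \<in> level_sets A m" for X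
  proof -
    obtain t where "length t = m + 1" "X = A t"
      using \<open>X \<in> level_sets A m\<close> unfolding level_sets_def by blast
    then show ?thesis using s by (intro below[of t]) auto
  qed
  ultimately have "ED_ideal A m \<subseteq> ?J"
    unfolding ED_ideal_def by (intro hull_minimal set_ideal_bounded_columns) blast
  then show ?thesis using X by blast
qed

lemma ED_ideal_subset:
  assumes "Y \<in> level_sets A m \<union> selectors A" "X \<subseteq> Y"
  shows "X \<in> ED_ideal A m"
  using assms unfolding ED_ideal_def hull_def set_ideal_def by blast

section \<open>Ultrafilters along the tree and the positive relation\<close>

text \<open>The number is the height of \<open>s\<close>; it is \<open>m + 1 - length s\<close> in the application.\<close>

primrec tree_filter :: "(nat list \<Rightarrow> nat set) \<Rightarrow> nat filter \<Rightarrow> nat \<Rightarrow> nat list \<Rightarrow> nat filter" where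
  "tree_filter A V 0 s = filtermap (enumerate (A s)) V"
| "tree_filter A V (Suc k) s = filter_bind V (\<lambda>n. tree_filter A V k (s @ [n]))"

lemma ultrafilter_tree_filter: "ultrafilter V \<Longrightarrow> ultrafilter (tree_filter A V k s)"
  by (induction k arbitrary: s) (auto intro: ultrafilter_filtermap ultrafilter_bind)

lemma tree_filter_le_cofinite:
  assumes A: "partition_tree A" and V: "V \<le> cofinite"
  shows "tree_filter A V k s \<le> cofinite"
proof (induction k arbitrary: s)
  case 0
  have "filtermap (enumerate (A s)) cofinite \<le> cofinite"
  proof (rule filter_leI)
    fix P :: "nat \<Rightarrow> bool" assume "eventually P cofinite"
    then have "finite (enumerate (A s) -` {x. \<not> P x})"
      using A by (intro finite_vimageI) (auto simp: eventually_cofinite partition_tree_def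
          intro!: strict_mono_imp_inj_on strict_mono_enumerate)
    then show "eventually P (filtermap (enumerate (A s)) cofinite)"
      by (simp add: eventually_filtermap eventually_cofinite vimage_def)
  qed
  with filtermap_mono[OF V, of "enumerate (A s)"] show ?case by simp
next
  case (Suc k)
  then show ?case by (simp add: filter_bind_le)
qed

lemma eventually_tree_filter_in:
  assumes A: "partition_tree A"
  shows "\<forall>\<^sub>F x in tree_filter A V k s. x \<in> A s"
proof (induction k arbitrary: s)
  case 0
  then show ?case
    using A by (simp add: eventually_filtermap partition_tree_def enumerate_in_set)
next
  case (Suc k)
  have "\<forall>\<^sub>F x in tree_filter A V k (s @ [n]). x \<in> A s" for n
    using Suc[of "s @ [n]"] partition_tree_mono[OF A, of s "[n]"] by (auto elim!: eventually_mono)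
  then show ?case by (simp add: eventually_filter_bind)
qed

text \<open>Stage \<open>N\<close> adds a block of \<open>N + 1\<close> points inside one piece of
  index at least \<open>N\<close>, joined in colour \<open>p\<close> to everything chosen before.
  The conclusion contradicts the bound in \<open>ED_ideal_bounded_columns\<close>, so the set is
  positive when \<open>length s <= m\<close>.\<close>

lemma ex_homogeneous_unbounded:
  assumes A: "partition_tree A" and V: "ultrafilter V" "V \<le> cofinite"
    and lim: "\<forall>\<^sub>F x in tree_filter A V (Suc k) s. \<forall>\<^sub>F y in tree_filter A V (Suc k) s. c {x, y} = p"
    and rich: "\<forall>\<^sub>F n in V. rich c (tree_filter A V k (s @ [n])) p"
  shows "\<exists>X. homogeneous c p X \<and>
           (\<forall>N. \<exists>n\<ge>N. infinite (X \<inter> A (s @ [n])) \<or> card (X \<inter> A (s @ [n])) > N)"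
proof -
  let ?U = "tree_filter A V (Suc k) s"
  define D where "D = {x. \<forall>\<^sub>F y in ?U. c {x, y} = p}"
  \<comment> \<open>Staying inside \<open>D\<close> keeps every finite stage extendable by a block from \<open>V\<close>-most pieces.\<close>
  define good where "good S \<longleftrightarrow> finite S \<and> S \<subseteq> D \<and> homogeneous c p S" for S
  have ge: "\<forall>\<^sub>F n in V. n \<ge> N" for N
    using V(2) by (simp add: cofinite_eq_sequentially le_filter_def eventually_ge_at_top)
  have step: "\<exists>T. good T \<and> S \<subseteq> T \<and> (\<exists>n\<ge>N. card (T \<inter> A (s @ [n])) > N)" if S: "good S" for S N
  proof -
    have "\<forall>\<^sub>F y in ?U. \<forall>x\<in>S. c {x, y} = p"
      using S by (intro eventually_ball_finite) (auto simp: good_def D_def)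
    with lim have "\<forall>\<^sub>F y in ?U. y \<in> D \<and> (\<forall>x\<in>S. c {x, y} = p)"
      by eventually_elim (simp add: D_def)
    then have "\<forall>\<^sub>F n in V. \<forall>\<^sub>F y in tree_filter A V k (s @ [n]). y \<in> D \<and> (\<forall>x\<in>S. c {x, y} = p)"
      by (simp add: eventually_filter_bind)
    with rich ge[of N] have "\<forall>\<^sub>F n in V. n \<ge> N \<and> rich c (tree_filter A V k (s @ [n])) p \<and>
        (\<forall>\<^sub>F y in tree_filter A V k (s @ [n]). y \<in> D \<and> (\<forall>x\<in>S. c {x, y} = p))"
      by eventually_elim blast
    from ultrafilter_happens[OF V(1) this]
    obtain n where n: "n \<ge> N" "rich c (tree_filter A V k (s @ [n])) p"
      "\<forall>\<^sub>F y in tree_filter A V k (s @ [n]). y \<in> D \<and> (\<forall>x\<in>S. c {x, y} = p)"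
      by (elim exE conjE)
    have "\<forall>\<^sub>F y in tree_filter A V k (s @ [n]). y \<in> A (s @ [n]) \<and> y \<in> D \<and> (\<forall>x\<in>S. c {x, y} = p)"
      using eventually_tree_filter_in[OF A] n(3) by (rule eventually_conj)
    from n(2)[unfolded rich_def, rule_format, OF this, of "Suc N"]
    obtain F where F: "F \<subseteq> {y. y \<in> A (s @ [n]) \<and> y \<in> D \<and> (\<forall>x\<in>S. c {x, y} = p)}"
      "finite F" "card F = Suc N" "homogeneous c p F"
      by (elim exE conjE)
    have "good (S \<union> F)"
      using S F unfolding good_def by (auto intro!: homogeneous_Un)
    moreover have "card ((S \<union> F) \<inter> A (s @ [n])) \<ge> card F"
      using F S by (intro card_mono) (auto simp: good_def)
    ultimately show ?thesis using F(3) n(1) by (intro exI[of _ "S \<union> F"]) auto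
  qed
  have "good {}" by (simp add: good_def homogeneous_def)
  then have "\<exists>S. \<forall>N. good (S N) \<and> (S N \<subseteq> S (Suc N) \<and> (\<exists>n\<ge>N. card (S (Suc N) \<inter> A (s @ [n])) > N))"
    using step by (intro dependent_nat_choice) blast+
  then obtain S where S: "\<And>N. good (S N)" "\<And>N. S N \<subseteq> S (Suc N)"
    "\<And>N. \<exists>n\<ge>N. card (S (Suc N) \<inter> A (s @ [n])) > N" by blast
  \<comment> \<open>The union may meet a piece in infinitely many points, where \<open>card\<close>
    is 0; hence the first alternative.\<close>
  have "\<exists>n\<ge>N. infinite ((\<Union>i. S i) \<inter> A (s @ [n])) \<or> card ((\<Union>i. S i) \<inter> A (s @ [n])) > N" for N
  proof -
    obtain n where n: "n \<ge> N" "card (S (Suc N) \<inter> A (s @ [n])) > N" using S(3) by blast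
    have "S (Suc N) \<inter> A (s @ [n]) \<subseteq> (\<Union>i. S i) \<inter> A (s @ [n])" by blast
    then show ?thesis using n by (meson card_mono less_le_trans)
  qed
  moreover have "homogeneous c p (\<Union>i. S i)"
    using S by (intro homogeneous_UN_chain) (auto simp: good_def)
  ultimately show ?thesis by blast
qed

lemma arrows_pairs_ED_ideal:
  assumes A: "partition_tree A"
  shows "arrows_pairs (positive_sets (ED_ideal A m)) (m + 1)"
  unfolding arrows_pairs_def
proof (intro allI impI)
  fix c :: "nat set \<Rightarrow> nat" assume c: "c \<in> nsets UNIV 2 \<rightarrow> {..<m + 1}"
  show "\<exists>X\<in>positive_sets (ED_ideal A m). card (c ` nsets X 2) = 1"
  proof (rule ccontr)
    assume contra: "\<not> ?thesis"
    obtain V :: "nat filter" where V: "ultrafilter V" "V \<le> cofinite"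
      using ex_ultrafilter_le[of "cofinite :: nat filter"] by auto
    let ?U = "tree_filter A V"
    let ?C = "\<lambda>k s. {p \<in> {..<m + 1}. rich c (?U k s) p}"
    have no_pos: False
      if s: "length s \<le> m" and hom: "homogeneous c p X"
        and unb: "\<forall>N. \<exists>n\<ge>N. infinite (X \<inter> A (s @ [n])) \<or> card (X \<inter> A (s @ [n])) > N"
      for s p X
    proof -
      have "X \<notin> ED_ideal A m"
      proof
        assume "X \<in> ED_ideal A m"
        from ED_ideal_bounded_columns[OF A s this] obtain N where
          N: "\<And>n. n \<ge> N \<Longrightarrow> finite (X \<inter> A (s @ [n])) \<and> card (X \<inter> A (s @ [n])) \<le> N" by blast
        obtain n where "n \<ge> N" "infinite (X \<inter> A (s @ [n])) \<or> card (X \<inter> A (s @ [n])) > N"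
          using unb by blast
        with N[of n] show False by auto
      qed
      \<comment> \<open>Positivity is not enough for the arrow relation as encoded: two distinct
        points are needed to make the set of attained colours nonempty.\<close>
      moreover obtain n where n: "infinite (X \<inter> A (s @ [n])) \<or> card (X \<inter> A (s @ [n])) > 1"
        using unb by blast
      then have "\<not> X \<subseteq> {z}" for z
      proof (rule contrapos_pn)
        assume "X \<subseteq> {z}"
        then have "X \<inter> A (s @ [n]) \<subseteq> {z}" by blast
        then show "\<not> (infinite (X \<inter> A (s @ [n])) \<or> card (X \<inter> A (s @ [n])) > 1)"
          by (auto dest: subset_singletonD)
      qed
      then obtain x y where "x \<in> X" "y \<in> X" "x \<noteq> y" by blast
      then have "card (c ` nsets X 2) = 1"
        using hom by (intro homogeneous_card_image)
      ultimately show False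
        using contra by (auto simp: positive_sets_def)
    qed
    \<comment> \<open>Each step towards the root adds a colour: height 0 gives one, and the root, at
      height \<open>m + 1\<close>, would need \<open>m + 2\<close> of the \<open>m + 1\<close>
      available.\<close>
    have "card (?C k s) \<ge> Suc k" if "length s + k = m + 1" for k s
      using that
    proof (induction k arbitrary: s)
      case 0
      obtain p where "p < m + 1" "\<forall>\<^sub>F x in ?U 0 s. \<forall>\<^sub>F y in ?U 0 s. c {x, y} = p"
        using ex_limit_colour[OF ultrafilter_tree_filter[OF V(1)] tree_filter_le_cofinite[OF A V(2)] c]
        by blast
      then have "p \<in> ?C 0 s"
        using rich_of_limit_colour[OF ultrafilter_tree_filter[OF V(1)] tree_filter_le_cofinite[OF A V(2)]]
        by blast
      then have "{p} \<subseteq> ?C 0 s" by blast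
      then have "card {p} \<le> card (?C 0 s)" by (intro card_mono) auto
      then show ?case by simp
    next
      case (Suc k)
      have IH: "card (?C k (s @ [n])) \<ge> Suc k" for n
        using Suc.prems by (intro Suc.IH) simp
      obtain p where p: "p < m + 1" and
        lim: "\<forall>\<^sub>F x in ?U (Suc k) s. \<forall>\<^sub>F y in ?U (Suc k) s. c {x, y} = p"
        using ex_limit_colour[OF ultrafilter_tree_filter[OF V(1)] tree_filter_le_cofinite[OF A V(2)] c]
        by blast
      have pC: "p \<in> ?C (Suc k) s"
        using p lim rich_of_limit_colour[OF ultrafilter_tree_filter[OF V(1)] tree_filter_le_cofinite[OF A V(2)]]
        by blast
      \<comment> \<open>The colour sets of the pieces take finitely many values, so
        \<open>V\<close>-most pieces share the same set \<open>C\<close>.\<close>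
      have "\<exists>C\<in>Pow {..<m + 1}. \<forall>\<^sub>F n in V. ?C k (s @ [n]) = C"
        using V(1) by (intro ultrafilter_finite_range always_eventually) auto
      then obtain C where C: "\<forall>\<^sub>F n in V. ?C k (s @ [n]) = C" by blast
      have "p \<notin> C"
      proof
        assume "p \<in> C"
        with C have "\<forall>\<^sub>F n in V. rich c (?U k (s @ [n])) p"
          by (auto elim: eventually_mono)
        from ex_homogeneous_unbounded[OF A V lim this] obtain X where "homogeneous c p X"
          "\<forall>N. \<exists>n\<ge>N. infinite (X \<inter> A (s @ [n])) \<or> card (X \<inter> A (s @ [n])) > N" by blast
        moreover have "length s \<le> m" using Suc.prems by simp
        ultimately show False by (intro no_pos)
      qed
      \<comment> \<open>A set large for the parent is large for \<open>V\<close>-most pieces, and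
        any one of them with colour set \<open>C\<close> provides the required finite set.\<close>
      moreover have "C \<subseteq> ?C (Suc k) s"
      proof
        fix q assume "q \<in> C"
        have "rich c (?U (Suc k) s) q"
          unfolding rich_def
        proof (intro allI impI)
          fix P N assume "eventually P (?U (Suc k) s)"
          then have "\<forall>\<^sub>F n in V. eventually P (?U k (s @ [n]))"
            by (simp add: eventually_filter_bind)
          with C have "\<forall>\<^sub>F n in V. ?C k (s @ [n]) = C \<and> eventually P (?U k (s @ [n]))"
            by (rule eventually_conj)
          then obtain n where "?C k (s @ [n]) = C" "eventually P (?U k (s @ [n]))"
            using ultrafilter_happens[OF V(1)] by blast
          moreover from this have "rich c (?U k (s @ [n])) q"
            using \<open>q \<in> C\<close> by blast
          ultimately show "\<exists>H. H \<subseteq> Collect P \<and> finite H \<and> card H = N \<and> homogeneous c q H"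
            by (simp add: rich_def)
        qed
        moreover obtain n where "?C k (s @ [n]) = C"
          using ultrafilter_happens[OF V(1) C] by blast
        then have "q < m + 1" using \<open>q \<in> C\<close> by auto
        ultimately show "q \<in> ?C (Suc k) s" by simp
      qed
      ultimately have "insert p C \<subseteq> ?C (Suc k) s" "card (insert p C) = Suc (card C)" "finite C"
        using pC finite_subset[of C "?C (Suc k) s"] by (auto simp: card_insert_if)
      moreover obtain n where "?C k (s @ [n]) = C"
        using ultrafilter_happens[OF V(1) C] by blast
      then have "card C \<ge> Suc k" using IH[of n] by simp
      moreover have "card (insert p C) \<le> card (?C (Suc k) s)"
        using calculation(1) by (intro card_mono) auto
      ultimately show ?case by simp
    qed
    from this[of "[]" "m + 1"] have "card (?C (m + 1) []) \<ge> m + 2" by simp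
    moreover have "card (?C (m + 1) []) \<le> card {..<m + 1}" by (intro card_mono) auto
    ultimately show False by simp
  qed
qed

section \<open>The negative relation\<close>

text \<open>A selector must meet every piece, so \<open>X\<close> is completed: \<open>f n\<close>
  is the point of \<open>X\<close> in the piece when there is one, and an arbitrary point of the
  piece otherwise.\<close>

lemma partial_selector_in_ED_ideal:
  assumes A: "partition_tree A" and X: "X \<subseteq> A t"
    and one: "\<And>n x y. x \<in> X \<inter> A (t @ [n]) \<Longrightarrow> y \<in> X \<inter> A (t @ [n]) \<Longrightarrow> x = y"
  shows "X \<in> ED_ideal A m"
proof -
  have ne: "A (t @ [n]) \<noteq> {}" for n
  proof -
    have "infinite (A (t @ [n]))" using A by (simp add: partition_tree_def)
    then show ?thesis by auto
  qed
  then have "\<exists>x. x \<in> A (t @ [n]) \<and> (X \<inter> A (t @ [n]) \<noteq> {} \<longrightarrow> x \<in> X)" for n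
    by blast
  then obtain f where f: "\<And>n. f n \<in> A (t @ [n])" "\<And>n. X \<inter> A (t @ [n]) \<noteq> {} \<Longrightarrow> f n \<in> X"
    by metis
  have "range f \<inter> A (t @ [n]) = {f n}" for n
  proof -
    have "k = n" if "f k \<in> A (t @ [n])" for k
      using partition_tree_disjoint[OF A _ f(1)[of k] that] by simp
    then show ?thesis using f(1)[of n] by auto
  qed
  moreover have "range f \<subseteq> A t"
    by (intro image_subsetI subsetD[OF partition_tree_mono[OF A] f(1)])
  ultimately have "range f \<in> selectors A"
    unfolding selectors_def by (intro CollectI exI[of _ t]) simp
  moreover have "X \<subseteq> range f"
  proof
    fix x assume "x \<in> X"
    moreover have "(\<Union>n. A (t @ [n])) = A t"
      using A by (simp add: partition_tree_def)
    ultimately obtain n where "x \<in> A (t @ [n])" using X by blast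
    moreover from this have "f n \<in> X" using \<open>x \<in> X\<close> f(2)[of n] by blast
    ultimately have "x = f n" using \<open>x \<in> X\<close> f(1)[of n] by (intro one[of _ n]) auto
    then show "x \<in> range f" by simp
  qed
  ultimately show ?thesis using ED_ideal_subset[of "range f" A m X] by simp
qed

lemma not_arrows_pairs_ED_ideal:
  assumes A: "partition_tree A"
  shows "\<not> arrows_pairs (positive_sets (ED_ideal A m)) (m + 2)"
proof
  assume "arrows_pairs (positive_sets (ED_ideal A m)) (m + 2)"
  \<comment> \<open>The root puts 0 into every \<open>L e\<close>, so the maximum exists; the cap at
    \<open>m + 1\<close> leaves exactly the \<open>m + 2\<close> colours from 0 to
    \<open>m + 1\<close>.\<close>
  define L where "L e = {j. j \<le> m + 1 \<and> (\<exists>t. length t = j \<and> e \<subseteq> A t)}" for e :: "nat set"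
  define c where "c e = Max (L e)" for e
  have fin: "finite (L e)" for e
    unfolding L_def by (rule finite_subset[of _ "{..m + 1}"]) auto
  have "0 \<in> L e" for e
    using A unfolding L_def partition_tree_def by simp
  then have cL: "c e \<in> L e" for e
    unfolding c_def using fin by (intro Max_in) auto
  have cge: "j \<le> c e" if "j \<in> L e" for j e
    unfolding c_def using fin that by simp
  have "c \<in> nsets UNIV 2 \<rightarrow> {..<m + 2}"
  proof
    fix e show "c e \<in> {..<m + 2}"
      using cL[of e] by (simp add: L_def)
  qed
  then obtain X where X: "X \<notin> ED_ideal A m" "card (c ` nsets X 2) = 1"
    using \<open>arrows_pairs _ _\<close> unfolding arrows_pairs_def positive_sets_def by blast
  then obtain i where i: "c ` nsets X 2 = {i}" by (meson card_1_singletonE)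
  then have cX: "c {x, y} = i" if "x \<in> X" "y \<in> X" "x \<noteq> y" for x y
    using that by (auto simp: nsets_def)
  have "nsets X 2 \<noteq> {}" using i by blast
  then obtain a b where ab: "a \<in> X" "b \<in> X" "a \<noteq> b" by (auto simp: nsets_def card_2_iff)
  then obtain t where t: "length t = i" "i \<le> m + 1" "{a, b} \<subseteq> A t"
    using cX[OF ab] cL[of "{a, b}"] by (auto simp: L_def)
  \<comment> \<open>The point \<open>a\<close> serves as an anchor: each other point of
    \<open>X\<close> shares a piece of level \<open>i\<close> with \<open>a\<close>, and
    \<open>a\<close> lies in only one such piece.\<close>
  have XA: "X \<subseteq> A t"
  proof
    fix z assume "z \<in> X"
    show "z \<in> A t"
    proof (cases "z = a")
      case False
      then obtain u where "length u = i" "{a, z} \<subseteq> A u"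
        using cX[of a z] cL[of "{a, z}"] ab \<open>z \<in> X\<close> by (auto simp: L_def)
      moreover from this have "u = t"
        using t by (intro partition_tree_disjoint[OF A, of _ _ a]) auto
      ultimately show ?thesis by blast
    qed (use t in auto)
  qed
  show False
  proof (cases "i = m + 1")
    case True
    then have "A t \<in> level_sets A m" using t unfolding level_sets_def by blast
    then show False using ED_ideal_subset[of "A t" A m X] XA X(1) by blast
  next
    case False
    have "x = y" if "x \<in> X \<inter> A (t @ [n])" "y \<in> X \<inter> A (t @ [n])" for n x y
    proof (rule ccontr)
      assume "x \<noteq> y"
      \<comment> \<open>Since \<open>i < m + 1\<close>, level \<open>Suc i\<close> is still counted,
        so two points in a common piece of \<open>A t\<close> would get a colour above
        \<open>i\<close>.\<close>
      have "Suc i \<in> L {x, y}"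
        using that t False unfolding L_def by (auto intro!: exI[of _ "t @ [n]"])
      with cge cX \<open>x \<noteq> y\<close> that show False by (metis IntD1 not_less_eq_eq order_refl)
    qed
    then show False using partial_selector_in_ED_ideal[OF A XA] X(1) by blast
  qed
qed

theorem theorem2p1:
  fixes A :: "nat list \<Rightarrow> nat set" and m :: nat
  assumes "partition_tree A"
  shows "arrows_pairs (positive_sets (ED_ideal A m)) (m + 1) \<and>
         \<not> arrows_pairs (positive_sets (ED_ideal A m)) (m + 2)"
  using arrows_pairs_ED_ideal[OF assms] not_arrows_pairs_ED_ideal[OF assms] ..

end
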